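(* Let $F$ be a field with $\operatorname{Char}(F)\neq 2$ and let $R$ be an associative unital $F$-algebra. Let $*$ be an involution on $R$ of the first kind with set of symmetric elements $S$, and assume $S\subsetneq R$. If $S$ is a commutative set, then $S^2\neq R$.
   Context: $S=\{r\in R: r^*=r\}$. The involution $*$ is of the first kind if $Z(R)\subseteq S$, where $Z(R)$ is the center of $R$. A subset $A\subseteq R$ is a commutative set if $xy=yx$ for all $x,y\in A$. $S^2$ denotes the $F$-subspace of $R$ generated by all products $ab$ with $a,b\in S$. *)

theory Defs
  imports "HOL-Computational_Algebra.Computational_Algebra"
begin

locale unital_algebra = vector_space scale
  for scale :: "'f::field \<Rightarrow> 'r::ring_1 \<Rightarrow> 'r" +
  assumes scale_mult_left: "scale a (x * y) = scale a x * y"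
    and scale_mult_right: "scale a (x * y) = x * scale a y"

(* Compatibility with scalars is not required here.  It follows for involutions of the
   first kind, because scalar multiples of 1 are central and hence symmetric. *)
definition ring_involution :: "('r::ring_1 \<Rightarrow> 'r) \<Rightarrow> bool" where
  "ring_involution star \<longleftrightarrow>
     (\<forall>x y. star (x + y) = star x + star y) \<and>
     (\<forall>x y. star (x * y) = star y * star x) \<and>
     (\<forall>x. star (star x) = x)"

definition symmetric_elements :: "('r \<Rightarrow> 'r) \<Rightarrow> 'r set" where
  "symmetric_elements star = {r. star r = r}"

definition ring_center :: "'r::ring_1 set" where
  "ring_center = {z. \<forall>x. z * x = x * z}"

definition first_kind :: "('r::ring_1 \<Rightarrow> 'r) \<Rightarrow> bool" where
  "first_kind star \<longleftrightarrow> ring_center \<subseteq> symmetric_elements star"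

definition commutative_set :: "'r::ring_1 set \<Rightarrow> bool" where
  "commutative_set A \<longleftrightarrow> (\<forall>x\<in>A. \<forall>y\<in>A. x * y = y * x)"

definition square_span :: "('f::field \<Rightarrow> 'r::ring_1 \<Rightarrow> 'r) \<Rightarrow> 'r set \<Rightarrow> 'r set" where
  "square_span scale A = module.span scale {a * b | a b. a \<in> A \<and> b \<in> A}"

end

theory Submission
  imports Defs
begin

text \<open>
  If the symmetric elements commute with each other, then the product of two of them is again
  symmetric, because an involution reverses products. An involution of the first kind fixes the
  central elements \<open>c \<cdot> 1\<close> and is therefore linear, so the symmetric elements also form a
  subspace. Hence the span of their products contains only symmetric elements
  (\<open>square_span_symmetric_subset\<close>), and it cannot be the whole ring when some element is not
  symmetric.
\<close>

lemma symmetric_mult_closed: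
  assumes "ring_involution star"
    and "commutative_set (symmetric_elements star)"
    and "a \<in> symmetric_elements star" "b \<in> symmetric_elements star"
  shows "a * b \<in> symmetric_elements star"
  using assms by (simp add: ring_involution_def commutative_set_def symmetric_elements_def)

context unital_algebra
begin

lemma scale_one_mult: "scale c 1 * x = scale c x"
  by (simp flip: scale_mult_left)

lemma scale_one_central: "scale c 1 \<in> ring_center"
  by (simp add: ring_center_def scale_one_mult flip: scale_mult_right)

text \<open>
  Scalar multiplication by \<open>c\<close> is multiplication by the central element \<open>c \<cdot> 1\<close>, which an
  involution of the first kind fixes; this is what makes the involution linear.
\<close>

lemma involution_scale:
  assumes "ring_involution star" and "first_kind star"
  shows "star (scale c x) = scale c (star x)"
proof -
  have fixed: "star (scale c 1) = scale c 1"
    using assms(2) scale_one_central by (auto simp: first_kind_def symmetric_elements_def)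
  have "star (scale c x) = star (scale c 1 * x)"
    by (simp add: scale_one_mult)
  also have "\<dots> = star x * scale c 1"
    using assms(1) fixed by (simp add: ring_involution_def)
  also have "\<dots> = scale c (star x)"
    by (simp flip: scale_mult_right)
  finally show ?thesis .
qed

lemma subspace_symmetric:
  assumes "ring_involution star" and "first_kind star"
  shows "subspace (symmetric_elements star)"
proof (rule subspaceI)
  have "(0 :: 'r) \<in> ring_center"
    by (simp add: ring_center_def)
  then show "0 \<in> symmetric_elements star"
    using assms(2) by (auto simp: first_kind_def)
next
  fix x y assume "x \<in> symmetric_elements star" "y \<in> symmetric_elements star"
  then show "x + y \<in> symmetric_elements star"
    using assms(1) by (simp add: ring_involution_def symmetric_elements_def)
next
  fix c x assume "x \<in> symmetric_elements star"
  then show "scale c x \<in> symmetric_elements star"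
    using involution_scale[OF assms] by (simp add: symmetric_elements_def)
qed

lemma square_span_symmetric_subset:
  assumes "ring_involution star" and "first_kind star"
    and "commutative_set (symmetric_elements star)"
  shows "square_span scale (symmetric_elements star) \<subseteq> symmetric_elements star"
  unfolding square_span_def
  by (rule span_minimal)
    (use symmetric_mult_closed[OF assms(1,3)] subspace_symmetric[OF assms(1,2)] in auto)

end

theorem proposition1p1:
  fixes scale :: "'f::field \<Rightarrow> 'r::ring_1 \<Rightarrow> 'r"
    and star :: "'r \<Rightarrow> 'r"
  assumes "CHAR('f) \<noteq> 2"
    and "unital_algebra scale"
    and "ring_involution star"
    and "first_kind star"
    and "symmetric_elements star \<subset> UNIV"
    and "commutative_set (symmetric_elements star)"
  shows "square_span scale (symmetric_elements star) \<noteq> UNIV"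
  using unital_algebra.square_span_symmetric_subset[OF assms(2-4,6)] assms(5) by blast

end
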